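(* Let $M=M(q,n)$ be the matroid on $E=\mathbb{P}^{n-1}(\mathbb{F}_q)$ given by linear independence over $\mathbb{F}_q$, let $k$ be a field of characteristic zero, and let $1\le l\le [n/2]$. Let $\mathcal{F}_l$ be the set of independent sets of cardinality $l$, let $m_l$ be the number of elements of $\overline{\mathcal{F}}_l=\mathcal{F}_l/\!\sim$, and let $F_1,\ldots,F_{m_l}\in\mathcal{F}_l$ be a complete set of representatives of $\overline{\mathcal{F}}_l$. Then the determinant of the matrix $$\left(\partial^{F_i}\partial^{F_j}\Phi_M\right)_{i,j=1}^{m_l}$$ is not identically zero, i.e. it is a nonzero polynomial in $k[x_e\mid e\in E]$.
   Context: $q$ is a prime power and $n\geq 1$. The matroid $M(q,n)=(E,\mathcal{F})$ has ground set $E=\mathbb{P}^{n-1}(\mathbb{F}_q)$, and $F\subset E$ belongs to $\mathcal{F}$ (is independent) iff its points are linearly independent over $\mathbb{F}_q$. For $S,T\subset E$, $S\sim T$ means that $S$ and $T$ have the same matroid closure, i.e. span the same linear subspace. With $\mathcal{B}$ the set of bases (maximal independent sets) of $M$, $\Phi_M=\sum_{B\in\mathcal{B}}\prod_{b\in B}x_b\in k[x_e\mid e\in E]$. For $S\subset E$, $\partial^S=\prod_{e\in S}\partial/\partial x_e$. *)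

theory Defs
  imports
    "HOL-Analysis.Cartesian_Space"
    "HOL-Library.Poly_Mapping"
    "Jordan_Normal_Form.Determinant"
begin

section \<open>Matroids given by their independent sets\<close>

text \<open>
  The ground set is the whole type \<open>'e\<close>, which is finite wherever these notions are used.
\<close>

definition matroid_bases :: "('e set \<Rightarrow> bool) \<Rightarrow> 'e set set" where
  "matroid_bases indep = {B. indep B \<and> (\<forall>I. indep I \<longrightarrow> B \<subseteq> I \<longrightarrow> I = B)}"

definition matroid_rank :: "('e set \<Rightarrow> bool) \<Rightarrow> 'e set \<Rightarrow> nat" where
  "matroid_rank indep S = Max (card ` {I. I \<subseteq> S \<and> indep I})"

definition matroid_closure :: "('e set \<Rightarrow> bool) \<Rightarrow> 'e set \<Rightarrow> 'e set" where
  "matroid_closure indep S = {e. matroid_rank indep (insert e S) = matroid_rank indep S}"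

definition indep_sets_of_card :: "('e set \<Rightarrow> bool) \<Rightarrow> nat \<Rightarrow> 'e set set" where
  "indep_sets_of_card indep l = {S. indep S \<and> card S = l}"

definition same_closure_on ::
    "('e set \<Rightarrow> bool) \<Rightarrow> 'e set set \<Rightarrow> ('e set \<times> 'e set) set" where
  "same_closure_on indep A =
     {(S, T). S \<in> A \<and> T \<in> A \<and> matroid_closure indep S = matroid_closure indep T}"

lemma equiv_same_closure_on: "equiv A (same_closure_on indep A)"
  by (auto simp: equiv_def refl_on_def sym_def trans_def same_closure_on_def)


section \<open>Polynomials in the variables \<open>x\<^sub>e\<close> and their partial derivatives\<close>

type_synonym ('e, 'k) mpoly = "('e \<Rightarrow>\<^sub>0 nat) \<Rightarrow>\<^sub>0 'k"

definition mvar :: "'e \<Rightarrow> ('e, 'k::comm_semiring_1) mpoly" where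
  "mvar e = Poly_Mapping.single (Poly_Mapping.single e 1) 1"

text \<open>
  The derivative of \<open>c x\<^sup>m\<close> by \<open>x\<^sub>e\<close> is \<open>m\<^sub>e c x\<^bsup>m - e\<^esup>\<close>; for \<open>m\<^sub>e = 0\<close> the subtraction truncates,
  but then the coefficient vanishes.
\<close>

definition mderiv :: "'e \<Rightarrow> ('e, 'k::comm_ring_1) mpoly \<Rightarrow> ('e, 'k) mpoly" where
  "mderiv e p = (\<Sum>m\<in>Poly_Mapping.keys p.
     Poly_Mapping.single (m - Poly_Mapping.single e 1)
       (of_nat (Poly_Mapping.lookup m e) * Poly_Mapping.lookup p m))"

lemma lookup_mderiv:
  "Poly_Mapping.lookup (mderiv e p) m =
     of_nat (Suc (Poly_Mapping.lookup m e)) *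
     Poly_Mapping.lookup p (m + Poly_Mapping.single e 1)"
proof -
  let ?s = "Poly_Mapping.single e (1::nat)"
  have eq: "(of_nat (Poly_Mapping.lookup k e) * Poly_Mapping.lookup p k when k - ?s = m) =
      (of_nat (Suc (Poly_Mapping.lookup m e)) * Poly_Mapping.lookup p (m + ?s) when k = m + ?s)"
    for k
  proof (cases "Poly_Mapping.lookup k e = 0")
    case True
    then have "k \<noteq> m + ?s"
      by (auto simp: lookup_add)
    with True show ?thesis by simp
  next
    case False
    have "k - ?s + ?s = k"
    proof (rule poly_mapping_eqI)
      fix x
      show "Poly_Mapping.lookup (k - ?s + ?s) x = Poly_Mapping.lookup k x"
        using False by (cases "x = e") (auto simp: lookup_add lookup_minus lookup_single)
    qed
    then have "k - ?s = m \<longleftrightarrow> k = m + ?s"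
      by auto
    then show ?thesis
      by (auto simp: when_def lookup_add)
  qed
  have "Poly_Mapping.lookup (mderiv e p) m =
      (\<Sum>k\<in>Poly_Mapping.keys p.
         of_nat (Poly_Mapping.lookup k e) * Poly_Mapping.lookup p k when k - ?s = m)"
    by (simp add: mderiv_def lookup_sum lookup_single)
  also have "\<dots> = (\<Sum>k\<in>Poly_Mapping.keys p.
         of_nat (Suc (Poly_Mapping.lookup m e)) * Poly_Mapping.lookup p (m + ?s) when k = m + ?s)"
    by (simp only: eq)
  also have "\<dots> = of_nat (Suc (Poly_Mapping.lookup m e)) * Poly_Mapping.lookup p (m + ?s)"
    by (auto simp: when_def sum.delta in_keys_iff)
  finally show ?thesis .
qed

lemma mderiv_commute: "mderiv e (mderiv f p) = mderiv f (mderiv e p)"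
  by (cases "e = f")
     (auto intro!: poly_mapping_eqI simp: lookup_mderiv lookup_add lookup_single ac_simps)

text \<open>
  The fold does not depend on the order in which \<open>S\<close> is traversed, by the commutation just shown.
\<close>

definition mderivs :: "'e set \<Rightarrow> ('e, 'k::comm_ring_1) mpoly \<Rightarrow> ('e, 'k) mpoly" where
  "mderivs S p = Finite_Set.fold mderiv p S"

lemma mderivs_empty [simp]: "mderivs {} p = p"
  by (simp add: mderivs_def)

lemma mderivs_insert [simp]:
  "finite S \<Longrightarrow> e \<notin> S \<Longrightarrow> mderivs (insert e S) p = mderiv e (mderivs S p)"
  unfolding mderivs_def
  by (rule comp_fun_commute_on.fold_insert[where S = UNIV])
     (auto simp: comp_fun_commute_on_def fun_eq_iff mderiv_commute)

definition basis_poly :: "('e set \<Rightarrow> bool) \<Rightarrow> ('e, 'k::comm_ring_1) mpoly" where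
  "basis_poly indep = (\<Sum>B\<in>matroid_bases indep. \<Prod>b\<in>B. mvar b)"


section \<open>The matroid of a projective space\<close>

typedef (overloaded) ('q, 'n) proj_space = "{L :: ('q::field ^ 'n::finite) set. vec.subspace L \<and> vec.dim L = 1}"
  morphisms line_of Proj
proof
  show "vec.span {axis undefined 1} \<in>
      {L :: ('q ^ 'n) set. vec.subspace L \<and> vec.dim L = 1}"
    by (simp add: vec.subspace_span axis_eq_0_iff)
qed

instance proj_space :: ("{field,finite}", finite) finite
proof
  have "inj (line_of :: ('a, 'b) proj_space \<Rightarrow> _)"
    by (simp add: inj_on_def line_of_inject)
  then show "finite (UNIV :: ('a, 'b) proj_space set)"
    using finite_imageD finite by blast
qed

text \<open>
  Points are linearly independent if their homogeneous coordinate vectors \<open>v P\<close> are; this does not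
  depend on the choice of \<open>v\<close> (see \<open>proj_indep_iff\<close> below).  Distinct points have distinct
  coordinate vectors, so no independent set can arise from \<open>v\<close> identifying two points.
\<close>

definition proj_indep :: "('q::field, 'n::finite) proj_space set \<Rightarrow> bool" where
  "proj_indep S \<longleftrightarrow>
     (\<forall>v. (\<forall>P\<in>S. v P \<in> line_of P \<and> v P \<noteq> 0) \<longrightarrow> vec.independent (v ` S))"

lemma line_of_eq_span:
  assumes "v \<in> line_of P" "v \<noteq> 0"
  shows "line_of P = vec.span {v}"
proof -
  have L: "vec.subspace (line_of P)" "vec.dim (line_of P) = 1"
    using line_of[of P] by auto
  have "vec.span {v} \<subseteq> line_of P"
    using assms L by (intro vec.span_minimal) auto
  moreover have "vec.dim (vec.span {v}) = 1"
    using assms by simp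
  ultimately show ?thesis
    using L vec.subspace_dim_equal[of "vec.span {v}" "line_of P"] vec.subspace_span[of "{v}"] by simp
qed

lemma line_of_nonzero: "\<exists>v. v \<in> line_of P \<and> v \<noteq> 0"
proof (rule ccontr)
  assume "\<nexists>v. v \<in> line_of P \<and> v \<noteq> 0"
  then have "line_of P = {} \<or> line_of P = {0}" by auto
  moreover have "vec.dim (line_of P) = 1" using line_of[of P] by simp
  ultimately show False by (auto simp del: One_nat_def)
qed

lemma inj_on_coords:
  assumes "\<forall>P\<in>S. v P \<in> line_of P \<and> v P \<noteq> 0"
  shows "inj_on v S"
proof (rule inj_onI)
  fix P Q assume "P \<in> S" "Q \<in> S" "v P = v Q"
  with assms have "line_of P = line_of Q"
    using line_of_eq_span[of "v P" P] line_of_eq_span[of "v P" Q] by auto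
  then show "P = Q" by (simp add: line_of_inject)
qed

lemma span_coords:
  assumes "\<forall>P\<in>S. v P \<in> line_of P \<and> v P \<noteq> 0"
  shows "vec.span (v ` S) = vec.span (\<Union>P\<in>S. line_of P)"
proof
  show "vec.span (v ` S) \<subseteq> vec.span (\<Union>P\<in>S. line_of P)"
    using assms by (intro vec.span_mono) auto
  have "line_of P \<subseteq> vec.span (v ` S)" if "P \<in> S" for P
    using assms that line_of_eq_span[of "v P" P] vec.span_mono[of "{v P}" "v ` S"] by auto
  then show "vec.span (\<Union>P\<in>S. line_of P) \<subseteq> vec.span (v ` S)"
    by (intro vec.span_minimal) auto
qed

lemma independent_iff_dim_card:
  fixes A :: "('q::field ^ 'n::finite) set"
  assumes "finite A"
  shows "vec.independent A \<longleftrightarrow> vec.dim A = card A"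
  using assms vec.dim_eq_card_independent vec.card_le_dim_spanning[of A "vec.span A"]
  by (auto simp: vec.span_superset)

lemma proj_indep_iff:
  fixes S :: "('q::{field,finite}, 'n::finite) proj_space set"
  assumes v: "\<forall>P\<in>S. v P \<in> line_of P \<and> v P \<noteq> 0"
  shows "proj_indep S \<longleftrightarrow> vec.independent (v ` S)"
proof -
  have "vec.independent (w ` S)"
    if w: "\<forall>P\<in>S. w P \<in> line_of P \<and> w P \<noteq> 0" and ind: "vec.independent (v ` S)" for w
  proof -
    have "vec.dim (w ` S) = vec.dim (v ` S)"
      using span_coords[OF v] span_coords[OF w] by (metis vec.dim_span)
    also have "\<dots> = card (w ` S)"
      using ind by (simp add: vec.dim_eq_card_independent card_image inj_on_coords[OF v] inj_on_coords[OF w])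
    finally show ?thesis
      by (simp add: independent_iff_dim_card)
  qed
  with v show ?thesis
    unfolding proj_indep_def by blast
qed

lemma matroid_rank_proj_indep:
  fixes S :: "('q::{field,finite}, 'n::finite) proj_space set"
  shows "matroid_rank proj_indep S = vec.dim (\<Union>P\<in>S. line_of P)"
proof -
  obtain v where v: "v P \<in> line_of P \<and> v P \<noteq> 0" for P :: "('q, 'n) proj_space"
    using line_of_nonzero by metis
  have inj: "inj_on v A" for A
    by (rule inj_on_coords) (use v in blast)
  have ind: "proj_indep A \<longleftrightarrow> vec.independent (v ` A)" for A
    by (rule proj_indep_iff) (use v in blast)
  have dim: "vec.dim (\<Union>P\<in>S. line_of P) = vec.dim (v ` S)"
    using span_coords[of S v] v by (metis vec.dim_span)
  obtain B where B: "B \<subseteq> v ` S" "vec.independent B" "card B = vec.dim (v ` S)"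
    using vec.basis_exists by metis
  then obtain I where I: "I \<subseteq> S" "B = v ` I"
    by (meson subset_imageE)
  show ?thesis
    unfolding matroid_rank_def dim
  proof (rule Max_eqI)
    show "vec.dim (v ` S) \<in> card ` {I. I \<subseteq> S \<and> proj_indep I}"
      using I B by (auto simp: ind card_image[OF inj] intro!: image_eqI[of _ _ I])
  next
    fix y assume "y \<in> card ` {I. I \<subseteq> S \<and> proj_indep I}"
    then obtain J where "J \<subseteq> S" "proj_indep J" "y = card (v ` J)"
      by (auto simp: card_image[OF inj])
    then show "y \<le> vec.dim (v ` S)"
      by (auto simp: ind intro: vec.independent_card_le_dim)
  qed simp
qed

theorem same_matroid_closure_iff_same_span:
  fixes S T :: "('q::{field,finite}, 'n::finite) proj_space set"
  shows "matroid_closure proj_indep S = matroid_closure proj_indep T \<longleftrightarrow>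
    vec.span (\<Union>P\<in>S. line_of P) = vec.span (\<Union>P\<in>T. line_of P)"
proof -
  have cl: "P \<in> matroid_closure proj_indep A \<longleftrightarrow> line_of P \<subseteq> vec.span (\<Union>Q\<in>A. line_of Q)"
    for P and A :: "('q, 'n) proj_space set"
  proof -
    let ?U = "\<Union>Q\<in>A. line_of Q"
    have "P \<in> matroid_closure proj_indep A \<longleftrightarrow> vec.dim (line_of P \<union> ?U) = vec.dim ?U"
      by (simp add: matroid_closure_def matroid_rank_proj_indep)
    also have "\<dots> \<longleftrightarrow> vec.span ?U = vec.span (line_of P \<union> ?U)"
    proof
      assume "vec.dim (line_of P \<union> ?U) = vec.dim ?U"
      then show "vec.span ?U = vec.span (line_of P \<union> ?U)"
        by (intro vec.dim_eq_span) auto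
    next
      assume "vec.span ?U = vec.span (line_of P \<union> ?U)"
      then have "vec.dim (vec.span ?U) = vec.dim (vec.span (line_of P \<union> ?U))"
        by (rule arg_cong)
      then show "vec.dim (line_of P \<union> ?U) = vec.dim ?U"
        by (simp only: vec.dim_span)
    qed
    also have "\<dots> \<longleftrightarrow> line_of P \<subseteq> vec.span ?U"
    proof
      assume "vec.span ?U = vec.span (line_of P \<union> ?U)"
      then show "line_of P \<subseteq> vec.span ?U"
        using vec.span_superset[of "line_of P \<union> ?U"] by blast
    next
      assume "line_of P \<subseteq> vec.span ?U"
      then have "vec.span (line_of P \<union> ?U) \<subseteq> vec.span ?U"
        using vec.span_superset[of ?U] by (intro vec.span_minimal) auto
      then show "vec.span ?U = vec.span (line_of P \<union> ?U)"
        using vec.span_mono[of ?U "line_of P \<union> ?U"] by blast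
    qed
    finally show ?thesis .
  qed
  have span_cl: "vec.span (\<Union>P\<in>matroid_closure proj_indep A. line_of P) =
      vec.span (\<Union>P\<in>A. line_of P)" for A :: "('q, 'n) proj_space set"
  proof
    show "vec.span (\<Union>P\<in>matroid_closure proj_indep A. line_of P) \<subseteq> vec.span (\<Union>P\<in>A. line_of P)"
      by (rule vec.span_minimal) (auto simp: cl)
    have "A \<subseteq> matroid_closure proj_indep A"
      unfolding subset_iff cl using vec.span_superset[of "\<Union>P\<in>A. line_of P"] by blast
    then show "vec.span (\<Union>P\<in>A. line_of P) \<subseteq> vec.span (\<Union>P\<in>matroid_closure proj_indep A. line_of P)"
      by (intro vec.span_mono) auto
  qed
  show ?thesis
  proof
    assume "matroid_closure proj_indep S = matroid_closure proj_indep T"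
    then show "vec.span (\<Union>P\<in>S. line_of P) = vec.span (\<Union>P\<in>T. line_of P)"
      using span_cl[of S] span_cl[of T] by simp
  next
    assume "vec.span (\<Union>P\<in>S. line_of P) = vec.span (\<Union>P\<in>T. line_of P)"
    then show "matroid_closure proj_indep S = matroid_closure proj_indep T"
      by (auto simp: cl)
  qed
qed

end

theory Submission
  imports Defs
begin

text \<open>
  Evaluate all variables at 1.  The entry of the matrix at \<open>(i, j)\<close> becomes the number of bases
  containing \<open>F\<^sub>i \<union> F\<^sub>j\<close> if this union is disjoint and independent, and 0 otherwise.  All independent
  sets of size \<open>2l\<close> lie in the same number \<open>c > 0\<close> of bases, so the matrix is \<open>c\<close> times the
  trivial-intersection matrix of the \<open>l\<close>-dimensional subspaces.  Suppose \<open>f\<close> is in its kernel, i.e.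
  the sum of \<open>f W\<close> over all \<open>W\<close> with \<open>W \<inter> U = 0\<close> vanishes for all \<open>U\<close> of dimension \<open>l\<close>.  As \<open>2l \<le> n\<close>,
  adding these relations over the one-dimensional extensions of a smaller subspace \<open>X\<close> gives the same
  relation for every \<open>X\<close> of dimension at most \<open>l\<close>.  By induction on the dimension of \<open>X\<close> the sum of
  \<open>f W\<close> over all \<open>W \<supseteq> X\<close> vanishes as well: given this for the proper subspaces of \<open>X\<close>, it is the
  previous sum up to the factor \<open>\<mu>(0, X) \<noteq> 0\<close>.  For \<open>X\<close> of dimension \<open>l\<close> it is \<open>f X\<close>.
\<close>

section \<open>Counting in vector spaces over a finite field\<close>

text \<open>A new basis vector b adds one free coordinate: (k, x) |-> k b + x is a bijection from
  the product of the field with span B onto the span of \<open>insert b B\<close>.\<close>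

lemma card_span_independent:
  fixes B :: "('q::{field,finite} ^ 'n::finite) set"
  assumes "vec.independent B"
  shows "card (vec.span B) = CARD('q) ^ card B"
proof -
  have "finite B" by simp
  then show ?thesis using assms
  proof (induction B)
    case empty
    then show ?case by simp
  next
    case (insert b B)
    then have B: "vec.independent B" "b \<notin> vec.span B"
      by (auto simp: vec.independent_insert)
    let ?g = "\<lambda>(k, x). k *s b + x"
    have "inj_on ?g (UNIV \<times> vec.span B)"
    proof (rule inj_onI, clarify)
      fix k k' x x'
      assume x: "x \<in> vec.span B" "x' \<in> vec.span B" and eq: "k *s b + x = k' *s b + x'"
      have "(k - k') *s b = x' - x"
        using eq by (simp add: vec.scale_left_diff_distrib algebra_simps)
      also have "x' - x \<in> vec.span B"
        using x by (intro vec.span_diff)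
      finally have "k = k'"
        using B(2) vec.span_scale[of "(k - k') *s b" B "inverse (k - k')"] by (cases "k = k'") auto
      with eq show "k = k' \<and> x = x'" by simp
    qed
    moreover have "?g ` (UNIV \<times> vec.span B) = vec.span (insert b B)"
    proof (rule Set.set_eqI, rule iffI)
      fix y assume "y \<in> vec.span (insert b B)"
      then obtain k where "y - k *s b \<in> vec.span B"
        by (auto simp: vec.span_breakdown_eq)
      then show "y \<in> ?g ` (UNIV \<times> vec.span B)"
        by (intro image_eqI[of _ _ "(k, y - k *s b)"]) auto
    next
      fix y assume "y \<in> ?g ` (UNIV \<times> vec.span B)"
      then obtain k x where "y = k *s b + x" "x \<in> vec.span B" by auto
      then show "y \<in> vec.span (insert b B)"
        by (auto simp: vec.span_breakdown_eq intro!: exI[of _ k])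
    qed
    ultimately have "card (vec.span (insert b B)) = card ((UNIV :: 'q set) \<times> vec.span B)"
      by (metis card_image)
    then show ?case
      using insert B by (simp add: card_cartesian_product)
  qed
qed

lemma card_subspace:
  fixes S :: "('q::{field,finite} ^ 'n::finite) set"
  assumes "vec.subspace S"
  shows "card S = CARD('q) ^ vec.dim S"
proof -
  obtain B where B: "B \<subseteq> S" "vec.independent B" "S \<subseteq> vec.span B" "card B = vec.dim S"
    using vec.basis_exists by metis
  moreover have "vec.span B = S"
    using B assms vec.span_minimal by blast
  ultimately show ?thesis
    using card_span_independent by metis
qed

lemma CARD_field_gt_1: "CARD('q::{field,finite}) > 1"
proof -
  have "card {0, 1 :: 'q} \<le> CARD('q)"
    by (intro card_mono) auto
  then show ?thesis by simp
qed

lemma inj_on_add_subspaces: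
  fixes S T :: "('q::field ^ 'n::finite) set"
  assumes "vec.subspace S" "vec.subspace T" "S \<inter> T = {0}"
  shows "inj_on (\<lambda>(x, y). x + y) (S \<times> T)"
proof (rule inj_onI, clarify)
  fix x y x' y'
  assume xy: "x \<in> S" "x' \<in> S" "y \<in> T" "y' \<in> T" and eq: "x + y = x' + y'"
  have "x - x' = y' - y"
    using eq by (simp add: algebra_simps)
  moreover have "x - x' \<in> S" "y' - y \<in> T"
    using xy assms by (auto intro: vec.subspace_diff)
  ultimately have "x - x' \<in> S \<inter> T" by simp
  then have "x - x' = 0" unfolding assms(3) by simp
  then show "x = x' \<and> y = y'" using eq by simp
qed

text \<open>Addition maps span A x span B onto the span of the union. Comparing cardinalities,
  independence of the union amounts to injectivity of this map, and so does triviality of the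
  intersection.\<close>

lemma independent_Un_iff_span_Int:
  fixes A B :: "('q::{field,finite} ^ 'n::finite) set"
  assumes "vec.independent A" "vec.independent B" "A \<inter> B = {}"
  shows "vec.independent (A \<union> B) \<longleftrightarrow> vec.span A \<inter> vec.span B = {0}"
proof -
  let ?P = "vec.span A \<times> vec.span B" and ?add = "\<lambda>(x, y :: 'q ^ 'n). x + y"
  have im: "vec.span (A \<union> B) = ?add ` ?P"
    unfolding vec.span_Un by (auto simp: image_iff)
  have cP: "card ?P = CARD('q) ^ card (A \<union> B)"
    using assms by (simp add: card_cartesian_product card_span_independent card_Un_disjoint power_add)
  have cs: "card (vec.span (A \<union> B)) = CARD('q) ^ vec.dim (A \<union> B)"
    using card_subspace[OF vec.subspace_span[of "A \<union> B"]] by simp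
  have "vec.independent (A \<union> B) \<longleftrightarrow> card (?add ` ?P) = card ?P"
    unfolding independent_iff_dim_card[OF finite] im[symmetric] cs cP
    using CARD_field_gt_1[where 'q = 'q] power_inject_exp by blast
  also have "\<dots> \<longleftrightarrow> inj_on ?add ?P"
    by (metis card_image eq_card_imp_inj_on finite)
  also have "\<dots> \<longleftrightarrow> vec.span A \<inter> vec.span B = {0}"
  proof
    assume inj: "inj_on ?add ?P"
    have "x = 0" if "x \<in> vec.span A" "x \<in> vec.span B" for x
      using inj_onD[OF inj, of "(x, - x)" "(0, 0)"] that
      by (simp add: vec.span_neg vec.span_zero)
    then show "vec.span A \<inter> vec.span B = {0}"
      by (auto simp: vec.span_zero)
  qed (auto intro: inj_on_add_subspaces vec.subspace_span)
  finally show ?thesis .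
qed


section \<open>The incidence of trivially intersecting subspaces\<close>

text \<open>Induction from T = H downwards: the W containing T are grouped by T' = W \<inter> H, the
  groups with T' larger than T vanish by induction, and the total vanishes by
  \<open>f\<close>.\<close>

lemma sum_Int_eq_0:
  fixes f :: "('q::{field,finite} ^ 'n::finite) set \<Rightarrow> 'k::comm_ring_1"
  assumes W: "\<And>W. W \<in> \<W> \<Longrightarrow> vec.subspace W" and H: "vec.subspace H"
    and f: "\<And>T. vec.subspace T \<Longrightarrow> T \<subseteq> H \<Longrightarrow> (\<Sum>W | W \<in> \<W> \<and> T \<subseteq> W. f W) = 0"
    and T: "vec.subspace T" "T \<subseteq> H"
  shows "(\<Sum>W | W \<in> \<W> \<and> W \<inter> H = T. f W) = 0"
  using T
proof (induction "card (H - T)" arbitrary: T rule: less_induct)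
  case less
  let ?\<T> = "{T'. vec.subspace T' \<and> T \<subseteq> T' \<and> T' \<subseteq> H}"
  have "(\<Sum>W | W \<in> \<W> \<and> T \<subseteq> W. f W) =
      (\<Sum>T'\<in>?\<T>. \<Sum>W | W \<in> {W \<in> \<W>. T \<subseteq> W} \<and> W \<inter> H = T'. f W)"
    using less.prems W H by (intro sum.group[symmetric]) (auto intro: vec.subspace_inter)
  also have "\<dots> = (\<Sum>T'\<in>?\<T>. \<Sum>W | W \<in> \<W> \<and> W \<inter> H = T'. f W)"
    by (intro sum.cong refl) auto
  also have "\<dots> = (\<Sum>T'\<in>{T}. \<Sum>W | W \<in> \<W> \<and> W \<inter> H = T'. f W)"
  proof (rule sum.mono_neutral_right)
    show "\<forall>T'\<in>?\<T> - {T}. (\<Sum>W | W \<in> \<W> \<and> W \<inter> H = T'. f W) = 0"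
    proof
      fix T' assume "T' \<in> ?\<T> - {T}"
      then show "(\<Sum>W | W \<in> \<W> \<and> W \<inter> H = T'. f W) = 0"
        by (intro less.hyps psubset_card_mono) auto
    qed
  qed (use less.prems in auto)
  finally show ?case
    using f[OF less.prems] by simp
qed

text \<open>
  The factor relating the two sums is the Moebius function of the interval \<open>[T, X]\<close>; only its
  nonvanishing matters.  Its sign is found by comparing \<open>X\<close> with a maximal subspace \<open>H\<close> containing
  \<open>T\<close>: every \<open>T' \<noteq> T\<close> with \<open>T' \<inter> H = T\<close> is one dimension larger than \<open>T\<close>.
\<close>

lemma sum_Int_eq_moebius:
  fixes f :: "('q::{field,finite} ^ 'n::finite) set \<Rightarrow> 'k::comm_ring_1"
  assumes W: "\<And>W. W \<in> \<W> \<Longrightarrow> vec.subspace W" and X: "vec.subspace X"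
    and f: "\<And>T. vec.subspace T \<Longrightarrow> T \<subset> X \<Longrightarrow> (\<Sum>W | W \<in> \<W> \<and> T \<subseteq> W. f W) = 0"
    and T: "vec.subspace T" "T \<subseteq> X"
  shows "\<exists>c > 0. (\<Sum>W | W \<in> \<W> \<and> W \<inter> X = T. f W) =
    (-1) ^ (vec.dim X - vec.dim T) * of_nat c * (\<Sum>W | W \<in> \<W> \<and> X \<subseteq> W. f W)"
  using T
proof (induction "vec.dim X - vec.dim T" arbitrary: T rule: less_induct)
  case less
  let ?q = "\<lambda>T. \<Sum>W | W \<in> \<W> \<and> W \<inter> X = T. f W" and ?s = "\<Sum>W | W \<in> \<W> \<and> X \<subseteq> W. f W"
  show ?case
  proof (cases "T = X")
    case True
    then have "?q T = ?s"
      by (intro sum.cong) auto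
    with True show ?thesis
      by (intro exI[of _ 1]) simp
  next
    case False
    let ?\<H> = "{H. vec.subspace H \<and> T \<subseteq> H \<and> H \<subset> X}"
    have "T \<in> ?\<H>" using less.prems False by auto
    then obtain H where "H \<in> ?\<H>" and max: "\<And>H'. H' \<in> ?\<H> \<Longrightarrow> H \<subseteq> H' \<Longrightarrow> H = H'"
      using finite_has_maximal2[of ?\<H> T] by auto
    then have H: "vec.subspace H" "T \<subseteq> H" "H \<subset> X" by auto
    \<comment> \<open>Maximality makes H a hyperplane of X.\<close>
    have X_eq: "vec.span (insert x H) = X" if "x \<in> X" "x \<notin> H" for x
    proof (rule ccontr)
      assume "vec.span (insert x H) \<noteq> X"
      moreover have "vec.span (insert x H) \<subseteq> X"
        using that H X by (intro vec.span_minimal) auto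
      ultimately have "vec.span (insert x H) \<in> ?\<H>"
        using H vec.span_superset[of "insert x H"] by (auto simp: vec.subspace_span)
      from max[OF this] that show False
        using vec.span_superset[of "insert x H"] by auto
    qed
    define \<T> where "\<T> = {T'. vec.subspace T' \<and> T' \<subseteq> X \<and> T' \<inter> H = T}"
    have T_in: "T \<in> \<T>" using less.prems H by (auto simp: \<T>_def)
    have dim_T': "vec.dim T' = Suc (vec.dim T) \<and> vec.dim T' \<le> vec.dim X" if T': "T' \<in> \<T>" "T' \<noteq> T" for T'
    proof -
      obtain x where x: "x \<in> T'" "x \<notin> H" using T' by (auto simp: \<T>_def)
      \<comment> \<open>Modulo H, y is a multiple of x, and the remainder lies in T' \<inter> H =
        T.\<close>
      have "y \<in> vec.span (insert x T)" if y: "y \<in> T'" for y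
      proof -
        have "y \<in> vec.span (insert x H)"
          using X_eq[of x] x y T' by (auto simp: \<T>_def)
        then obtain k where "y - k *s x \<in> H"
          using H by (auto simp: vec.span_breakdown_eq vec.span_eq_iff[THEN iffD2])
        moreover have "y - k *s x \<in> T'"
          using x y T' by (auto simp: \<T>_def intro: vec.subspace_diff vec.subspace_scale)
        ultimately have "y - k *s x \<in> vec.span T"
          using T' by (auto simp: \<T>_def intro: vec.span_base)
        then show ?thesis by (auto simp: vec.span_breakdown_eq)
      qed
      moreover have "insert x T \<subseteq> T'" using x T' by (auto simp: \<T>_def)
      then have "vec.span (insert x T) \<subseteq> T'"
        using T' by (intro vec.span_minimal) (auto simp: \<T>_def)
      ultimately have "vec.span (insert x T) = T'" by blast
      then have "vec.dim T' = vec.dim (insert x T)"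
        by (metis vec.dim_span)
      also have "\<dots> = Suc (vec.dim T)"
        using x H less.prems by (auto simp: vec.dim_insert vec.span_eq_iff[THEN iffD2])
      finally show ?thesis
        using T' vec.dim_subset[of T' X] by (simp add: \<T>_def)
    qed
    \<comment> \<open>Any such x yields a member of \<open>\<T> - {T}\<close>; this makes the sum of
      the constants at the end positive.\<close>
    obtain x where x: "x \<in> X" "x \<notin> H" using H by auto
    have "vec.span (insert x T) \<in> \<T> - {T}"
    proof -
      have "y \<in> T" if y: "y \<in> vec.span (insert x T)" "y \<in> H" for y
      proof -
        obtain k where k: "y - k *s x \<in> T"
          using y less.prems by (auto simp: vec.span_breakdown_eq vec.span_eq_iff[THEN iffD2])
        have "y - (y - k *s x) \<in> H"
          by (rule vec.subspace_diff[OF H(1) y(2) subsetD[OF H(2) k]])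
        then have "k *s x \<in> H" by simp
        then have "inverse k *s (k *s x) \<in> H"
          by (rule vec.subspace_scale[OF H(1)])
        with x have "k = 0" by (cases "k = 0") auto
        with k show ?thesis by simp
      qed
      moreover have "insert x T \<subseteq> vec.span (insert x T)" by (rule vec.span_superset)
      moreover have "vec.span (insert x T) \<subseteq> X"
        using x less.prems X by (intro vec.span_minimal) auto
      ultimately show ?thesis
        using x H by (auto simp: \<T>_def vec.subspace_span)
    qed
    then have ne: "\<T> - {T} \<noteq> {}" by blast
    \<comment> \<open>As H is proper in X, \<open>sum_Int_eq_0\<close> applies to it. Refining the
      condition W \<inter> H = T by the value of W \<inter> X expresses \<open>?q T\<close> through
      the terms already treated.\<close>
    have "0 = (\<Sum>W | W \<in> \<W> \<and> W \<inter> H = T. f W)"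
      using W H f less.prems by (intro sum_Int_eq_0[symmetric]) auto
    also have "\<dots> = (\<Sum>T'\<in>\<T>. \<Sum>W | W \<in> {W \<in> \<W>. W \<inter> H = T} \<and> W \<inter> X = T'. f W)"
      using W X H by (intro sum.group[symmetric]) (auto simp: \<T>_def intro: vec.subspace_inter)
    also have "\<dots> = (\<Sum>T'\<in>\<T>. ?q T')"
      using H by (intro sum.cong refl) (auto simp: \<T>_def)
    also have "\<dots> = ?q T + (\<Sum>T'\<in>\<T> - {T}. ?q T')"
      using T_in by (simp add: sum.remove)
    finally have q: "?q T = - (\<Sum>T'\<in>\<T> - {T}. ?q T')"
      by (simp add: eq_neg_iff_add_eq_0)
    \<comment> \<open>All members of \<open>\<T>\<close> other than T have codimension d in X, so
      their terms carry one common sign and cannot cancel. As such members exist, the subtraction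
      does not truncate.\<close>
    define d where "d = vec.dim X - Suc (vec.dim T)"
    have d: "vec.dim X - vec.dim T = Suc d"
      using dim_T' ne by (fastforce simp: d_def)
    have "\<exists>c > 0. ?q T' = (-1) ^ d * of_nat c * ?s" if T': "T' \<in> \<T> - {T}" for T'
    proof -
      have "vec.dim X - vec.dim T' = d" using dim_T'[of T'] T' by (simp add: d_def)
      with less.hyps[of T'] d T' show ?thesis by (auto simp: \<T>_def)
    qed
    then have "\<forall>T'\<in>\<T> - {T}. \<exists>c > 0. ?q T' = (-1) ^ d * of_nat c * ?s" ..
    from bchoice[OF this] obtain c
      where c: "\<forall>T'\<in>\<T> - {T}. c T' > 0 \<and> ?q T' = (-1) ^ d * of_nat (c T') * ?s" ..
    have "?q T = - (\<Sum>T'\<in>\<T> - {T}. (-1) ^ d * of_nat (c T') * ?s)"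
      unfolding q by (intro arg_cong[where f = uminus] sum.cong refl) (rule conjunct2[OF bspec[OF c]])
    also have "\<dots> = (-1) ^ Suc d * of_nat (\<Sum>T'\<in>\<T> - {T}. c T') * ?s"
      by (simp only: sum_distrib_left[symmetric] sum_distrib_right[symmetric] of_nat_sum[symmetric]) simp
    finally have "?q T = (-1) ^ Suc d * of_nat (\<Sum>T'\<in>\<T> - {T}. c T') * ?s" .
    moreover have "(\<Sum>T'\<in>\<T> - {T}. c T') > 0"
      using c ne by (intro sum_pos) auto
    ultimately show ?thesis unfolding d by blast
  qed
qed

text \<open>With T = 0 in \<open>sum_Int_eq_moebius\<close>, the left side vanishes by
  \<open>f\<close>, and the factor on the right is nonzero in characteristic zero.\<close>

lemma sum_superspaces_eq_0:
  fixes f :: "('q::{field,finite} ^ 'n::finite) set \<Rightarrow> 'k::field_char_0"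
  assumes W: "\<And>W. W \<in> \<W> \<Longrightarrow> vec.subspace W"
    and f: "\<And>X. vec.subspace X \<Longrightarrow> vec.dim X \<le> l \<Longrightarrow> (\<Sum>W | W \<in> \<W> \<and> W \<inter> X = {0}. f W) = 0"
    and X: "vec.subspace X" "vec.dim X \<le> l"
  shows "(\<Sum>W | W \<in> \<W> \<and> X \<subseteq> W. f W) = 0"
  using X
proof (induction "vec.dim X" arbitrary: X rule: less_induct)
  case less
  have "(\<Sum>W | W \<in> \<W> \<and> T \<subseteq> W. f W) = 0" if T: "vec.subspace T" "T \<subset> X" for T
  proof -
    have "vec.dim T < vec.dim X"
      using T less.prems by (intro vec.dim_psubset) (simp add: vec.span_eq_iff[THEN iffD2])
    then show ?thesis using less T by simp
  qed
  then obtain c where "c > 0"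
    "(\<Sum>W | W \<in> \<W> \<and> W \<inter> X = {0}. f W) =
      (-1) ^ (vec.dim X - vec.dim ({0} :: ('q ^ 'n) set)) * of_nat c * (\<Sum>W | W \<in> \<W> \<and> X \<subseteq> W. f W)"
    using sum_Int_eq_moebius[OF W, of \<W> X f "{0}"] less.prems
    by (auto simp: vec.subspace_0 vec.subspace_single_0)
  with f[OF less.prems] show ?case by simp
qed

text \<open>If W \<inter> X = 0, the vectors counted are exactly those outside W + X, a direct sum.
  A nonzero common vector of W and X survives in every extension of X.\<close>

lemma card_extensions_trivial_Int:
  fixes W X :: "('q::{field,finite} ^ 'n::finite) set"
  assumes W: "vec.subspace W" and X: "vec.subspace X"
  shows "card {v. v \<notin> X \<and> W \<inter> vec.span (insert v X) = {0}} =
    (if W \<inter> X = {0} then CARD('q) ^ CARD('n) - CARD('q) ^ (vec.dim W + vec.dim X) else 0)"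
proof (cases "W \<inter> X = {0}")
  case True
  let ?WX = "(\<lambda>(x, y). x + y) ` (W \<times> X)"
  have WX: "card ?WX = CARD('q) ^ (vec.dim W + vec.dim X)"
    using card_image[OF inj_on_add_subspaces[OF W X True]]
    by (simp add: card_cartesian_product card_subspace W X power_add)
  have "{v. v \<notin> X \<and> W \<inter> vec.span (insert v X) = {0}} = UNIV - ?WX"
  proof (rule Set.set_eqI, rule iffI)
    fix v assume v: "v \<in> {v. v \<notin> X \<and> W \<inter> vec.span (insert v X) = {0}}"
    have "v \<noteq> w + x" if "w \<in> W" "x \<in> X" for w x
    proof
      assume vwx: "v = w + x"
      \<comment> \<open>The explicit scalar 1 is the witness for
        \<open>vec.span_breakdown_eq\<close>.\<close>
      have "w - 1 *s v \<in> vec.span X"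
        using vwx that X by (auto intro!: vec.subspace_neg vec.span_base)
      then have "w \<in> W \<inter> vec.span (insert v X)"
        using that by (auto simp only: vec.span_breakdown_eq Int_iff)
      with v have "w = 0" by auto
      with v vwx that show False by simp
    qed
    then show "v \<in> UNIV - ?WX" by auto
  next
    fix v assume v: "v \<in> UNIV - ?WX"
    have "0 + x \<in> ?WX" if "x \<in> X" for x
      using that vec.subspace_0[OF W] by (intro image_eqI[of _ _ "(0, x)"]) auto
    then have nX: "v \<notin> X"
      using v by auto
    have "w = 0" if w: "w \<in> W" "w \<in> vec.span (insert v X)" for w
    proof -
      obtain k where k: "w - k *s v \<in> X"
        using w X by (auto simp: vec.span_breakdown_eq vec.span_eq_iff[THEN iffD2])
      have "k = 0"
      proof (rule ccontr)
        assume "k \<noteq> 0"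
        \<comment> \<open>Solving for v would place it in W + X.\<close>
        then have "v = inverse k *s w + (- inverse k) *s (w - k *s v)"
          by (simp add: vec.scale_right_diff_distrib)
        moreover have "inverse k *s w \<in> W" "(- inverse k) *s (w - k *s v) \<in> X"
          using w k W X by (auto intro: vec.subspace_scale simp del: vec.scale_minus_left)
        ultimately have "v \<in> ?WX"
          by (intro image_eqI[of _ _ "(inverse k *s w, (- inverse k) *s (w - k *s v))"])
            (simp_all only: prod.case mem_Times_iff fst_conv snd_conv simp_thms)
        with v show False by blast
      qed
      with k w True show ?thesis by auto
    qed
    then have "W \<inter> vec.span (insert v X) = {0}"
      using vec.subspace_0[OF W] vec.span_zero[of "insert v X"] by blast
    with nX show "v \<in> {v. v \<notin> X \<and> W \<inter> vec.span (insert v X) = {0}}" by simp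
  qed
  then show ?thesis
    using True WX by (simp add: card_Diff_subset)
next
  case False
  have "W \<inter> X \<subseteq> W \<inter> vec.span (insert v X)" for v
    using vec.span_superset[of "insert v X"] by auto
  moreover have "0 \<in> W \<inter> X" using W X by (simp add: vec.subspace_0)
  ultimately have "W \<inter> vec.span (insert v X) \<noteq> {0}" for v
    using False by blast
  with False show ?thesis by simp
qed

text \<open>Descent from dimension l: each W meeting X trivially is compatible with the same number
  of vectors v, so exchanging the sums gives the relation for X times that number.\<close>

lemma sum_trivial_Int_eq_0:
  fixes f :: "('q::{field,finite} ^ 'n::finite) set \<Rightarrow> 'k::field_char_0"
  assumes l: "2 * l \<le> CARD('n)"
    and f: "\<And>U. vec.subspace U \<Longrightarrow> vec.dim U = l \<Longrightarrow>
      (\<Sum>W | W \<in> {W. vec.subspace W \<and> vec.dim W = l} \<and> W \<inter> U = {0}. f W) = 0"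
    and X: "vec.subspace X" "vec.dim X \<le> l"
  shows "(\<Sum>W | W \<in> {W. vec.subspace W \<and> vec.dim W = l} \<and> W \<inter> X = {0}. f W) = 0"
  using X
proof (induction "l - vec.dim X" arbitrary: X)
  case 0
  then show ?case using f by simp
next
  case (Suc d)
  let ?\<W> = "{W :: ('q ^ 'n) set. vec.subspace W \<and> vec.dim W = l}"
  let ?a = "CARD('q) ^ CARD('n) - CARD('q) ^ (l + vec.dim X)"
  \<comment> \<open>The sum runs over vectors instead of extensions of X; several v give the same
    extension, which merely repeats vanishing terms.\<close>
  have "0 = (\<Sum>v\<in>UNIV - X. \<Sum>W | W \<in> ?\<W> \<and> W \<inter> vec.span (insert v X) = {0}. f W)"
  proof (rule sum.neutral[symmetric], rule ballI)
    fix v assume "v \<in> UNIV - X"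
    then have "vec.dim (vec.span (insert v X)) = Suc (vec.dim X)"
      using Suc.prems by (simp add: vec.dim_insert vec.span_eq_iff[THEN iffD2])
    then show "(\<Sum>W | W \<in> ?\<W> \<and> W \<inter> vec.span (insert v X) = {0}. f W) = 0"
      using Suc.hyps(2) by (intro Suc.hyps(1)) (auto simp: vec.subspace_span)
  qed
  also have "\<dots> = (\<Sum>v\<in>UNIV - X. \<Sum>W\<in>?\<W>. if W \<inter> vec.span (insert v X) = {0} then f W else 0)"
    by (intro sum.cong refl sum.inter_filter) simp
  also have "\<dots> = (\<Sum>W\<in>?\<W>. \<Sum>v\<in>UNIV - X. if W \<inter> vec.span (insert v X) = {0} then f W else 0)"
    by (rule sum.swap)
  also have "\<dots> = (\<Sum>W\<in>?\<W>. \<Sum>v | v \<in> UNIV - X \<and> W \<inter> vec.span (insert v X) = {0}. f W)"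
    by (intro sum.cong refl sum.inter_filter[symmetric]) simp
  also have "\<dots> = (\<Sum>W\<in>?\<W>. if W \<inter> X = {0} then of_nat ?a * f W else 0)"
    using Suc.prems by (intro sum.cong) (auto simp: card_extensions_trivial_Int)
  also have "\<dots> = of_nat ?a * (\<Sum>W | W \<in> ?\<W> \<and> W \<inter> X = {0}. f W)"
    by (simp add: sum.inter_filter[symmetric] sum_distrib_left)
  finally have "of_nat ?a * (\<Sum>W | W \<in> ?\<W> \<and> W \<inter> X = {0}. f W) = 0" by simp
  \<comment> \<open>Here dim X < l, hence l + dim X < 2l \<le> n.\<close>
  moreover have "?a > 0"
    using l Suc.hyps(2) CARD_field_gt_1[where 'q = 'q] by (auto intro!: power_strict_increasing)
  ultimately show ?case
    by (simp only: mult_eq_0_iff of_nat_eq_0_iff) simp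
qed

text \<open>The only l-dimensional subspace containing U is U itself, so the sum over superspaces
  reduces to \<open>f U\<close>.\<close>

lemma trivial_Int_kernel:
  fixes f :: "('q::{field,finite} ^ 'n::finite) set \<Rightarrow> 'k::field_char_0"
  assumes l: "2 * l \<le> CARD('n)"
    and f: "\<And>U. vec.subspace U \<Longrightarrow> vec.dim U = l \<Longrightarrow>
      (\<Sum>W | W \<in> {W. vec.subspace W \<and> vec.dim W = l} \<and> W \<inter> U = {0}. f W) = 0"
    and U: "vec.subspace U" "vec.dim U = l"
  shows "f U = 0"
proof -
  let ?\<W> = "{W :: ('q ^ 'n) set. vec.subspace W \<and> vec.dim W = l}"
  have "{W. W \<in> ?\<W> \<and> U \<subseteq> W} = {U}"
    using U by (auto dest: vec.subspace_dim_equal)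
  moreover have "(\<Sum>W | W \<in> ?\<W> \<and> U \<subseteq> W. f W) = 0"
    using U by (intro sum_superspaces_eq_0[where l = l] sum_trivial_Int_eq_0[OF l f]) auto
  ultimately show ?thesis by simp
qed


section \<open>Bases of the projective matroid\<close>

text \<open>One fixed coordinate vector per point replaces the quantifier over \<open>v\<close> in
  \<open>proj_indep\<close> by a statement about a single set of vectors.\<close>

definition rep :: "('q::field, 'n::finite) proj_space \<Rightarrow> 'q ^ 'n" where
  "rep P = (SOME v. v \<in> line_of P \<and> v \<noteq> 0)"

lemma rep: "rep P \<in> line_of P" "rep P \<noteq> 0"
  using someI_ex[OF line_of_nonzero[of P]] by (auto simp: rep_def)

lemma inj_rep: "inj_on rep S"
  by (rule inj_on_coords) (simp add: rep)

lemma rep_in_image_iff [simp]: "rep P \<in> rep ` S \<longleftrightarrow> P \<in> S"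
  using inj_on_image_mem_iff[OF inj_rep, of P UNIV S] by simp

lemma proj_indep_iff_rep:
  fixes S :: "('q::{field,finite}, 'n::finite) proj_space set"
  shows "proj_indep S \<longleftrightarrow> vec.independent (rep ` S)"
  by (rule proj_indep_iff) (simp add: rep)

abbreviation pspan :: "('q::field, 'n::finite) proj_space set \<Rightarrow> ('q ^ 'n) set" where
  "pspan S \<equiv> vec.span (rep ` S)"

lemma dim_pspan:
  fixes S :: "('q::{field,finite}, 'n::finite) proj_space set"
  assumes "proj_indep S"
  shows "vec.dim (pspan S) = card S"
  using assms by (simp add: proj_indep_iff_rep vec.dim_eq_card_independent card_image[OF inj_rep])

lemma proj_indep_card_le:
  fixes S :: "('q::{field,finite}, 'n::finite) proj_space set"
  assumes "proj_indep S"
  shows "card S \<le> CARD('n)"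
  using dim_pspan[OF assms] dim_subset_UNIV_cart_gen[of "pspan S"] by simp

lemma proj_indep_mono:
  fixes S :: "('q::{field,finite}, 'n::finite) proj_space set"
  assumes "proj_indep T" "S \<subseteq> T"
  shows "proj_indep S"
  using assms vec.independent_mono[of "rep ` T" "rep ` S"] by (auto simp: proj_indep_iff_rep)

lemma proj_indep_insert_iff:
  fixes S :: "('q::{field,finite}, 'n::finite) proj_space set"
  assumes "P \<notin> S"
  shows "proj_indep (insert P S) \<longleftrightarrow> proj_indep S \<and> rep P \<notin> pspan S"
  using assms by (simp add: proj_indep_iff_rep vec.independent_insert)

text \<open>Disjointness belongs on the left: a common point puts a nonzero vector into both spans,
  although the union may still be independent.\<close>

lemma proj_indep_Un_iff:
  fixes S T :: "('q::{field,finite}, 'n::finite) proj_space set"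
  assumes "proj_indep S" "proj_indep T"
  shows "S \<inter> T = {} \<and> proj_indep (S \<union> T) \<longleftrightarrow> pspan S \<inter> pspan T = {0}"
proof (cases "S \<inter> T = {}")
  case True
  then have "rep ` S \<inter> rep ` T = {}"
    using inj_rep[of UNIV] by (auto dest: injD)
  then show ?thesis
    using independent_Un_iff_span_Int[of "rep ` S" "rep ` T"] assms True
    by (simp add: proj_indep_iff_rep image_Un)
next
  case False
  then obtain P where "P \<in> S" "P \<in> T" by auto
  then have "rep P \<in> pspan S \<inter> pspan T" by (auto intro: vec.span_base)
  then show ?thesis using False rep(2)[of P] by auto
qed

text \<open>The vectors outside S are partitioned by the lines not contained in S, each contributing
  its q - 1 nonzero vectors. The product form avoids division of natural numbers.\<close>

lemma card_points_outside:
  fixes S :: "('q::{field,finite} ^ 'n::finite) set"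
  assumes S: "vec.subspace S"
  shows "card {P :: ('q, 'n) proj_space. rep P \<notin> S} * (CARD('q) - 1) =
    CARD('q) ^ CARD('n) - CARD('q) ^ vec.dim S"
proof -
  let ?Ps = "{P :: ('q, 'n) proj_space. rep P \<notin> S}"
  have line: "v \<in> line_of P - {0} \<Longrightarrow> line_of P = vec.span {v}" for v and P :: "('q, 'n) proj_space"
    using line_of_eq_span by auto
  have "UNIV - S = (\<Union>P\<in>?Ps. line_of P - {0})"
  proof (rule Set.set_eqI, rule iffI)
    fix v assume v: "v \<in> UNIV - S"
    then have v0: "v \<noteq> 0" using vec.subspace_0[OF S] by auto
    then obtain P where P: "line_of P = vec.span {v}"
      using Proj_inverse[of "vec.span {v}"] by (auto simp: vec.subspace_span)
    then have "v \<in> line_of P - {0}" using v0 by (simp add: vec.span_base)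
    moreover have "rep P \<notin> S"
    proof
      assume "rep P \<in> S"
      then have "vec.span {rep P} \<subseteq> S" using S by (intro vec.span_minimal) auto
      then show False
        using v line_of_eq_span[OF rep[of P]] \<open>v \<in> line_of P - {0}\<close> by auto
    qed
    ultimately show "v \<in> (\<Union>P\<in>?Ps. line_of P - {0})" by blast
  next
    fix v assume "v \<in> (\<Union>P\<in>?Ps. line_of P - {0})"
    then obtain P where P: "rep P \<notin> S" "v \<in> line_of P - {0}" by auto
    have "rep P \<in> vec.span {v}" using line[OF P(2)] rep(1)[of P] by simp
    then have "v \<notin> S" using P(1) S vec.span_minimal[of "{v}" S] by auto
    then show "v \<in> UNIV - S" by simp
  qed
  then have "card (UNIV - S) = (\<Sum>P\<in>?Ps. card (line_of P - {0}))"
  proof (simp only:, intro card_UN_disjoint ballI impI)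
    fix P Q :: "('q, 'n) proj_space"
    assume "P \<noteq> Q"
    then have "line_of P \<noteq> line_of Q" by (simp add: line_of_inject)
    then show "(line_of P - {0}) \<inter> (line_of Q - {0}) = {}"
      using line[of _ P] line[of _ Q] by blast
  qed simp_all
  also have "\<dots> = (\<Sum>P\<in>?Ps. CARD('q) - 1)"
  proof (rule sum.cong[OF refl])
    fix P :: "('q, 'n) proj_space"
    have "vec.subspace (line_of P)" "vec.dim (line_of P) = 1"
      using line_of[of P] by auto
    then show "card (line_of P - {0}) = CARD('q) - 1"
      by (simp add: card_subspace card_Diff_singleton vec.subspace_0)
  qed
  finally show ?thesis
    by (simp add: card_Diff_subset card_subspace[OF S])
qed

lemma ex_point_outside:
  fixes S :: "('q::{field,finite} ^ 'n::finite) set"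
  assumes "vec.subspace S" "vec.dim S < CARD('n)"
  shows "\<exists>P :: ('q, 'n) proj_space. rep P \<notin> S"
proof -
  have "card {P :: ('q, 'n) proj_space. rep P \<notin> S} * (CARD('q) - 1) > 0"
    unfolding card_points_outside[OF assms(1)]
    using power_strict_increasing[OF assms(2) CARD_field_gt_1[where 'q = 'q]] by simp
  then have "{P :: ('q, 'n) proj_space. rep P \<notin> S} \<noteq> {}"
    by (metis card.empty mult_0 less_irrefl)
  then show ?thesis by blast
qed

text \<open>An independent set with fewer than n points extends by a point outside its span, and no
  independent set has more than n points.\<close>

lemma matroid_bases_proj_indep:
  "matroid_bases proj_indep =
    {B :: ('q::{field,finite}, 'n::finite) proj_space set. proj_indep B \<and> card B = CARD('n)}"
proof (rule Set.set_eqI, rule iffI)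
  fix B :: "('q, 'n) proj_space set"
  assume "B \<in> matroid_bases proj_indep"
  then have B: "proj_indep B" "\<And>I. proj_indep I \<Longrightarrow> B \<subseteq> I \<Longrightarrow> I = B"
    by (auto simp: matroid_bases_def)
  have "\<not> card B < CARD('n)"
  proof
    assume "card B < CARD('n)"
    then obtain P :: "('q, 'n) proj_space" where P: "rep P \<notin> pspan B"
      using ex_point_outside[OF vec.subspace_span, of "rep ` B"] by (auto simp only: dim_pspan[OF B(1)])
    then have PB: "P \<notin> B" by (auto intro: vec.span_base)
    then have "insert P B = B"
      using P B by (intro B(2)) (auto simp: proj_indep_insert_iff)
    with PB show False by auto
  qed
  with B show "B \<in> {B. proj_indep B \<and> card B = CARD('n)}"
    using proj_indep_card_le[of B] by auto
next
  fix B :: "('q, 'n) proj_space set"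
  assume B: "B \<in> {B. proj_indep B \<and> card B = CARD('n)}"
  have "I = B" if "proj_indep I" "B \<subseteq> I" for I
    using card_seteq[OF finite that(2)] proj_indep_card_le[OF that(1)] B by simp
  with B show "B \<in> matroid_bases proj_indep"
    by (simp add: matroid_bases_def)
qed

text \<open>
  By downward induction on the cardinality of an independent set \<open>I\<close>: the pairs \<open>(P, B)\<close> with \<open>B\<close> a
  basis containing \<open>I\<close> and \<open>P \<in> B - I\<close> are counted by \<open>B\<close> and by \<open>P\<close>.
\<close>

lemma card_bases_containing:
  assumes "k \<le> CARD('n)"
  shows "\<exists>c > 0. \<forall>I :: ('q::{field,finite}, 'n::finite) proj_space set.
    proj_indep I \<and> card I = k \<longrightarrow> card {B \<in> matroid_bases proj_indep. I \<subseteq> B} = c"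
  using assms
proof (induction k rule: inc_induct)
  case base
  have "{B \<in> matroid_bases proj_indep. I \<subseteq> B} = {I}"
    if "proj_indep I" "card I = CARD('n)" for I :: "('q, 'n) proj_space set"
  proof -
    have "I = B" if "I \<subseteq> B" "card B = CARD('n)" for B
      using card_subset_eq[OF finite that(1)] that \<open>card I = CARD('n)\<close> by simp
    with that show ?thesis
      by (auto simp: matroid_bases_proj_indep)
  qed
  then show ?case by (intro exI[of _ 1]) auto
next
  case (step k)
  let ?N = "\<lambda>I :: ('q, 'n) proj_space set. card {B \<in> matroid_bases proj_indep. I \<subseteq> B}"
  let ?p = "CARD('q) ^ CARD('n) - CARD('q) ^ k"
  obtain c where c: "c > 0" "\<And>I. proj_indep I \<Longrightarrow> card I = Suc k \<Longrightarrow> ?N I = c"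
    using step.IH by blast
  \<comment> \<open>The factor q - 1 clears the denominator in the number of points outside the span
    of I. The right side depends on k alone, so cancelling determines \<open>?N I\<close>.\<close>
  have eq: "?N I * ((CARD('n) - k) * (CARD('q) - 1)) = ?p * c" if I: "proj_indep I" "card I = k" for I
  proof -
    let ?\<B> = "{B \<in> matroid_bases proj_indep. I \<subseteq> B}"
    have out: "P \<notin> I" if "rep P \<notin> pspan I" for P
      using that by (auto intro: vec.span_base)
    have "card (B - I) = CARD('n) - k" if "B \<in> ?\<B>" for B
      using that I by (simp add: matroid_bases_proj_indep card_Diff_subset)
    then have "?N I * (CARD('n) - k) = (\<Sum>B\<in>?\<B>. card (B - I))"
      by simp
    \<comment> \<open>A point of B - I lies outside the span of I, because adding it to I gives a
      subset of the independent set B.\<close>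
    also have "\<dots> = (\<Sum>B\<in>?\<B>. card {P \<in> {P. rep P \<notin> pspan I}. P \<in> B})"
    proof (intro sum.cong refl arg_cong[where f = card] Set.set_eqI iffI)
      fix B P assume B: "B \<in> ?\<B>" and P: "P \<in> B - I"
      then have "proj_indep (insert P I)"
        by (auto simp: matroid_bases_proj_indep intro: proj_indep_mono[of B])
      with P show "P \<in> {P \<in> {P. rep P \<notin> pspan I}. P \<in> B}"
        using proj_indep_insert_iff[of P I] by auto
    qed (use out in auto)
    also have "\<dots> = (\<Sum>P | rep P \<notin> pspan I. card {B \<in> ?\<B>. P \<in> B})"
      by (rule sum_multicount_gen) simp_all
    also have "\<dots> = (\<Sum>P | rep P \<notin> pspan I. c)"
    proof (rule sum.cong[OF refl])
      fix P assume "P \<in> {P. rep P \<notin> pspan I}"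
      then have P: "proj_indep (insert P I)" "card (insert P I) = Suc k"
        using I out by (auto simp: proj_indep_insert_iff)
      have "{B \<in> ?\<B>. P \<in> B} = {B \<in> matroid_bases proj_indep. insert P I \<subseteq> B}" by auto
      then show "card {B \<in> ?\<B>. P \<in> B} = c" using c(2)[OF P] by (simp only:)
    qed
    finally have "?N I * (CARD('n) - k) = card {P. rep P \<notin> pspan I} * c" by simp
    moreover have "card {P. rep P \<notin> pspan I} * (CARD('q) - 1) = ?p"
      using card_points_outside[OF vec.subspace_span[of "rep ` I"]] dim_pspan[OF I(1)] I(2) by simp
    moreover have "a * (b * e) = f * g" if "a * b = d * g" "d * e = f" for a b d e f g :: nat
      using that by (metis mult.assoc mult.commute)
    ultimately show ?thesis by blast
  qed
  have "?p * c > 0"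
    using c(1) step.hyps power_strict_increasing[OF _ CARD_field_gt_1[where 'q = 'q]] by simp
  have nz: "(CARD('n) - k) * (CARD('q) - 1) \<noteq> 0"
    using step.hyps CARD_field_gt_1[where 'q = 'q] by simp
  show ?case
  \<comment> \<open>If there is no independent set of cardinality k, every positive constant serves;
    otherwise the constant is read off from one such set.\<close>
  proof (cases "\<exists>I :: ('q, 'n) proj_space set. proj_indep I \<and> card I = k")
    case True
    then obtain I0 :: "('q, 'n) proj_space set" where I0: "proj_indep I0" "card I0 = k" by blast
    have "?N I0 > 0"
      using \<open>?p * c > 0\<close> unfolding eq[OF I0, symmetric] by (simp only: nat_0_less_mult_iff)
    moreover have "?N I = ?N I0" if "proj_indep I" "card I = k" for I
      using eq[OF that, folded eq[OF I0]] by (simp only: mult_right_cancel[OF nz])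
    ultimately show ?thesis by blast
  qed auto
qed


section \<open>Evaluating polynomials at the all-one point\<close>

text \<open>Every monomial takes the value 1 at the all-one point, which leaves the sum of the
  coefficients.\<close>

definition eval_ones :: "('e, 'k::comm_ring_1) mpoly \<Rightarrow> 'k" where
  "eval_ones p = (\<Sum>m\<in>Poly_Mapping.keys p. Poly_Mapping.lookup p m)"

lemma eval_ones_single [simp]: "eval_ones (Poly_Mapping.single m c) = c"
  by (simp add: eval_ones_def)

lemma eval_ones_zero [simp]: "eval_ones 0 = 0"
  by (simp add: eval_ones_def)

lemma eval_ones_add: "eval_ones (p + q) = eval_ones p + eval_ones q"
  unfolding eval_ones_def by (rule setsum_keys_plus_distrib) auto

lemma eval_ones_sum: "eval_ones (\<Sum>i\<in>A. p i) = (\<Sum>i\<in>A. eval_ones (p i))"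
  by (induction A rule: infinite_finite_induct) (auto simp: eval_ones_add)

lemma sum_singles: "(\<Sum>m\<in>Poly_Mapping.keys p. Poly_Mapping.single m (Poly_Mapping.lookup p m)) = p"
  by (rule poly_mapping_eqI) (auto simp: lookup_sum lookup_single when_def sum.delta in_keys_iff)

lemma eval_ones_mult: "eval_ones (p * q) = eval_ones p * eval_ones q"
proof -
  let ?s = "\<lambda>p m. Poly_Mapping.single m (Poly_Mapping.lookup p m)"
  have "eval_ones (p * q) =
      eval_ones ((\<Sum>m\<in>Poly_Mapping.keys p. ?s p m) * (\<Sum>m\<in>Poly_Mapping.keys q. ?s q m))"
    by (simp only: sum_singles)
  also have "\<dots> = eval_ones p * eval_ones q"
    by (simp add: sum_product mult_single eval_ones_sum) (simp add: eval_ones_def sum_product)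
  finally show ?thesis .
qed

text \<open>Ring homomorphisms commute with determinants, so it suffices that the evaluated matrix
  is nonsingular.\<close>

interpretation eval_ones: comm_ring_hom "eval_ones :: ('e, 'k::comm_ring_1) mpoly \<Rightarrow> 'k"
  by unfold_locales
    (auto simp: eval_ones_add eval_ones_mult eval_ones_single[of 0 1, unfolded single_one])

section \<open>Iterated derivatives of squarefree monomials\<close>

lemma mderiv_zero [simp]: "mderiv e 0 = 0"
  by (simp add: mderiv_def)

lemma mderiv_add: "mderiv e (p + q) = mderiv e p + mderiv e q"
  by (rule poly_mapping_eqI) (simp add: lookup_mderiv lookup_add algebra_simps)

lemma mderivs_zero [simp]: "finite S \<Longrightarrow> mderivs S 0 = 0"
  by (induction S rule: finite_induct) simp_all

lemma mderivs_add: "finite S \<Longrightarrow> mderivs S (p + q) = mderivs S p + mderivs S q"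
  by (induction S rule: finite_induct) (simp_all add: mderiv_add)

lemma mderivs_sum: "finite S \<Longrightarrow> mderivs S (\<Sum>i\<in>A. p i) = (\<Sum>i\<in>A. mderivs S (p i))"
  by (induction A rule: infinite_finite_induct) (simp_all add: mderivs_add)

definition set_monomial :: "'e set \<Rightarrow> ('e, 'k::comm_ring_1) mpoly" where
  "set_monomial B = (\<Prod>b\<in>B. mvar b)"

lemma set_monomial_single:
  assumes "finite B"
  shows "set_monomial B = Poly_Mapping.single (\<Sum>b\<in>B. Poly_Mapping.single b 1) 1"
  using assms unfolding set_monomial_def
  by (induction B rule: finite_induct) (simp_all add: mvar_def mult_single)

text \<open>All exponents are at most 1, so differentiation introduces no integer factor.\<close>

lemma mderiv_set_monomial:
  assumes "finite B"
  shows "mderiv e (set_monomial B) = (if e \<in> B then set_monomial (B - {e}) else 0)"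
proof -
  let ?m = "\<lambda>B. \<Sum>b\<in>B. Poly_Mapping.single b (1::nat)"
  have l: "Poly_Mapping.lookup (?m B) e = (if e \<in> B then 1 else 0)"
    using assms by (simp add: lookup_sum lookup_single when_def)
  have "e \<in> B \<Longrightarrow> ?m B - Poly_Mapping.single e 1 = ?m (B - {e})"
    using assms by (simp add: sum.remove)
  then show ?thesis
    using assms l by (auto simp: set_monomial_single mderiv_def)
qed

lemma mderivs_set_monomial:
  assumes "finite B" "finite S"
  shows "mderivs S (set_monomial B) = (if S \<subseteq> B then set_monomial (B - S) else 0)"
  using assms(2)
proof (induction S rule: finite_induct)
  case (insert e S)
  then show ?case
    using assms(1) by (auto simp: mderiv_set_monomial set_diff_eq conj_commute conj_left_commute)
qed simp

text \<open>A variable in both S and T is differentiated twice and kills every squarefree monomial.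
  Otherwise each basis containing both sets leaves one monomial, of value 1.\<close>

lemma eval_ones_mderivs_basis_poly:
  fixes S T :: "'e::finite set"
  shows "eval_ones (mderivs S (mderivs T (basis_poly indep :: ('e, 'k::comm_ring_1) mpoly))) =
    (if S \<inter> T = {} then of_nat (card {B \<in> matroid_bases indep. S \<union> T \<subseteq> B}) else 0)"
proof -
  have e1: "eval_ones (set_monomial B :: ('e, 'k) mpoly) = 1" for B
    by (simp add: set_monomial_single)
  have "mderivs S (mderivs T (basis_poly indep :: ('e, 'k) mpoly)) =
      (\<Sum>B\<in>matroid_bases indep. mderivs S (mderivs T (set_monomial B)))"
    unfolding basis_poly_def set_monomial_def[symmetric] by (simp add: mderivs_sum)
  then have "eval_ones (mderivs S (mderivs T (basis_poly indep :: ('e, 'k) mpoly))) =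
      (\<Sum>B\<in>matroid_bases indep. if S \<inter> T = {} \<and> S \<union> T \<subseteq> B then 1 else 0)"
    by (auto simp: eval_ones_sum mderivs_set_monomial e1 intro!: sum.cong)
  also have "\<dots> = of_nat (card {B \<in> matroid_bases indep. S \<inter> T = {} \<and> S \<union> T \<subseteq> B})"
    by (simp add: sum.inter_filter[symmetric])
  finally show ?thesis by auto
qed

section \<open>The matrix of second derivatives and its kernel\<close>

theorem theorem4p2:
  fixes \<F>l :: "('q::{field,finite}, 'n::finite) proj_space set set"
    and F :: "nat \<Rightarrow> ('q, 'n) proj_space set"
    and \<Phi> :: "(('q, 'n) proj_space, 'k::field_char_0) mpoly"
    and l m :: nat
  assumes "1 \<le> l" and "l \<le> CARD('n) div 2"
    and "\<Phi> = basis_poly proj_indep"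
    and "\<F>l = indep_sets_of_card proj_indep l"
    and "m = card (\<F>l // same_closure_on proj_indep \<F>l)"
    and "\<And>i. i < m \<Longrightarrow> F i \<in> \<F>l"
    and "bij_betw (\<lambda>i. same_closure_on proj_indep \<F>l `` {F i}) {..<m}
           (\<F>l // same_closure_on proj_indep \<F>l)"
  shows "Determinant.det (Matrix.mat m m (\<lambda>(i, j). mderivs (F i) (mderivs (F j) \<Phi>))) \<noteq> 0"
proof
  let ?M = "Matrix.mat m m (\<lambda>(i, j). mderivs (F i) (mderivs (F j) \<Phi>))"
  let ?R = "same_closure_on proj_indep \<F>l"
  let ?\<W> = "{W :: ('q ^ 'n) set. vec.subspace W \<and> vec.dim W = l}"
  have F: "proj_indep (F i)" "card (F i) = l" if "i < m" for i
    using assms(6)[OF that] by (auto simp: assms(4) indep_sets_of_card_def)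
  have R: "(S, T) \<in> ?R \<longleftrightarrow> S \<in> \<F>l \<and> T \<in> \<F>l \<and> pspan S = pspan T" for S T
    using span_coords[of S rep] span_coords[of T rep]
    by (simp add: rep same_closure_on_def same_matroid_closure_iff_same_span)
  \<comment> \<open>By \<open>R\<close> a class is determined by its span, so rows and columns can
    be indexed by the l-dimensional subspaces.\<close>
  have bij: "bij_betw (\<lambda>i. pspan (F i)) {..<m} ?\<W>"
  proof (rule bij_betw_imageI)
    show "inj_on (\<lambda>i. pspan (F i)) {..<m}"
    proof (rule inj_onI)
      fix i j assume ij: "i \<in> {..<m}" "j \<in> {..<m}" "pspan (F i) = pspan (F j)"
      then have "?R `` {F i} = ?R `` {F j}"
        using assms(6) by (auto simp: R)
      with assms(7) ij show "i = j"
        by (auto simp: bij_betw_def dest: inj_onD)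
    qed
    show "(\<lambda>i. pspan (F i)) ` {..<m} = ?\<W>"
    proof (rule Set.set_eqI, rule iffI)
      fix W assume W: "W \<in> ?\<W>"
      obtain B where B: "B \<subseteq> W" "vec.independent B" "W \<subseteq> vec.span B" "card B = vec.dim W"
        using vec.basis_exists by metis
      have span_B: "vec.span B = W" using B W vec.span_minimal by blast
      have "\<exists>P :: ('q, 'n) proj_space. b \<in> line_of P \<and> b \<noteq> 0" if "b \<in> B" for b
      proof -
        have "b \<noteq> 0" using B(2) that vec.dependent_zero by blast
        then show ?thesis
          using Proj_inverse[of "vec.span {b}"]
          by (intro exI[of _ "Proj (vec.span {b})"]) (auto simp: vec.subspace_span vec.span_base)
      qed
      then obtain p :: "'q ^ 'n \<Rightarrow> ('q, 'n) proj_space"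
        where p: "\<And>b. b \<in> B \<Longrightarrow> b \<in> line_of (p b) \<and> b \<noteq> 0" by metis
      let ?S = "p ` B"
      have "pspan ?S = W"
      proof -
        have "vec.span {rep (p b)} = vec.span {b}" if "b \<in> B" for b
          using line_of_eq_span[OF rep[of "p b"]] line_of_eq_span[of b "p b"] p[OF that] by simp
        then have "rep (p b) \<in> vec.span B" "b \<in> pspan ?S" if "b \<in> B" for b
          using that vec.span_mono[of "{b}" B] vec.span_mono[of "{rep (p b)}" "rep ` p ` B"]
            vec.span_base[of _ "{b}"] vec.span_base[of _ "{rep (p b)}"] by blast+
        then show ?thesis
          unfolding span_B[symmetric]
          by (intro subset_antisym vec.span_minimal) (auto simp: vec.subspace_span)
      qed
      \<comment> \<open>The points span W, so there are at least l of them; as images of the l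
        vectors in B there are at most l. This settles independence as well.\<close>
      then have "card ?S = l" "proj_indep ?S"
      proof -
        have d: "vec.dim (rep ` ?S) = l" using \<open>pspan ?S = W\<close> W by (metis (mono_tags, lifting) mem_Collect_eq vec.dim_span)
        have "l \<le> card (rep ` ?S)" using d vec.dim_le_card[OF vec.span_superset finite, of "rep ` ?S"] by simp
        then have c: "l \<le> card ?S" by (simp add: card_image[OF inj_rep])
        have "card ?S \<le> l" using B(4) W card_image_le[of B p] by auto
        with c show "card ?S = l" by simp
        with d show "proj_indep ?S"
          by (simp add: proj_indep_iff_rep independent_iff_dim_card card_image[OF inj_rep])
      qed
      then have S: "?S \<in> \<F>l" by (simp add: assms(4) indep_sets_of_card_def)
      then have "?R `` {?S} \<in> \<F>l // ?R" by (rule quotientI)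
      then have "?R `` {?S} \<in> (\<lambda>i. ?R `` {F i}) ` {..<m}"
        using assms(7) by (simp add: bij_betw_def)
      then obtain i where i: "i < m" "?R `` {F i} = ?R `` {?S}" by auto
      have "(?S, ?S) \<in> ?R" using S by (simp add: R)
      then have "(F i, ?S) \<in> ?R" using i by blast
      then have "pspan (F i) = W" using \<open>pspan ?S = W\<close> by (simp add: R)
      with i show "W \<in> (\<lambda>i. pspan (F i)) ` {..<m}" by auto
    qed (auto simp: F dim_pspan[simplified] vec.subspace_span)
  qed
  obtain c where c: "c > 0" "\<And>I :: ('q, 'n) proj_space set. proj_indep I \<Longrightarrow> card I = 2 * l \<Longrightarrow>
      card {B \<in> matroid_bases proj_indep. I \<subseteq> B} = c"
  proof -
    have "2 * l \<le> CARD('n)" using assms(2) by simp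
    from card_bases_containing[OF this, where 'q = 'q] that show ?thesis by blast
  qed
  \<comment> \<open>A dependent union lies in no basis, and a disjoint one has 2l points, the
    cardinality to which c belongs. The column index stands first to match W \<inter> U in
    \<open>trivial_Int_kernel\<close>.\<close>
  have entry: "eval_ones (mderivs (F i) (mderivs (F j) \<Phi>)) =
      (if pspan (F j) \<inter> pspan (F i) = {0} then of_nat c else 0)" if ij: "i < m" "j < m" for i j
  proof -
    have iff: "F i \<inter> F j = {} \<and> proj_indep (F i \<union> F j) \<longleftrightarrow> pspan (F j) \<inter> pspan (F i) = {0}"
      using proj_indep_Un_iff[of "F i" "F j"] F ij by auto
    have "{B \<in> matroid_bases proj_indep. F i \<union> F j \<subseteq> B} = {}" if "\<not> proj_indep (F i \<union> F j)"
      using that proj_indep_mono by (fastforce simp: matroid_bases_def)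
    moreover have "card (F i \<union> F j) = 2 * l" if "F i \<inter> F j = {}"
      using that F ij by (simp add: card_Un_disjoint)
    ultimately show ?thesis
      unfolding assms(3) eval_ones_mderivs_basis_poly iff[symmetric] using c(2)[of "F i \<union> F j"] by auto
  qed
  assume "Determinant.det ?M = 0"
  then have "Determinant.det (map_mat eval_ones ?M) = 0" by simp
  then obtain v where v: "v \<in> carrier_vec m" "v \<noteq> 0\<^sub>v m" "map_mat eval_ones ?M *\<^sub>v v = 0\<^sub>v m"
    using det_0_iff_vec_prod_zero_field[of "map_mat eval_ones ?M" m] by auto
  \<comment> \<open>The kernel vector, transported along \<open>bij\<close> to a function on
    subspaces.\<close>
  define f where "f W = vec_index v (inv_into {..<m} (\<lambda>i. pspan (F i)) W)" for W
  have f: "f (pspan (F j)) = vec_index v j" if "j < m" for j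
    using inv_into_f_f[OF bij_betw_imp_inj_on[OF bij], of j] that by (simp add: f_def)
  have ker: "(\<Sum>W | W \<in> ?\<W> \<and> W \<inter> U = {0}. f W) = 0" if U: "vec.subspace U" "vec.dim U = l" for U
  proof -
    have "U \<in> (\<lambda>i. pspan (F i)) ` {..<m}"
      using U by (simp add: bij_betw_imp_surj_on[OF bij])
    then obtain i where i: "i < m" "U = pspan (F i)" by auto
    have "0 = vec_index (map_mat eval_ones ?M *\<^sub>v v) i" using i v(3) by simp
    also have "\<dots> = (\<Sum>j<m. eval_ones (mderivs (F i) (mderivs (F j) \<Phi>)) * vec_index v j)"
      using i v(1) by (auto simp: scalar_prod_def lessThan_atLeast0 intro!: sum.cong)
    also have "\<dots> = (\<Sum>j<m. if pspan (F j) \<inter> U = {0} then of_nat c * f (pspan (F j)) else 0)"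
      using i by (intro sum.cong) (auto simp: entry f)
    also have "\<dots> = (\<Sum>W\<in>?\<W>. if W \<inter> U = {0} then of_nat c * f W else 0)"
      by (rule sum.reindex_bij_betw[OF bij])
    \<comment> \<open>The common factor c can be cancelled, being nonzero in characteristic
      zero.\<close>
    also have "\<dots> = of_nat c * (\<Sum>W | W \<in> ?\<W> \<and> W \<inter> U = {0}. f W)"
      by (simp add: sum.inter_filter[symmetric] sum_distrib_left)
    finally show ?thesis using c(1) by simp
  qed
  have "vec_index v j = 0" if "j < m" for j
  proof -
    have "f (pspan (F j)) = 0"
    proof (rule trivial_Int_kernel[where l = l])
      show "2 * l \<le> CARD('n)" using assms(2) by simp
      show "vec.dim (pspan (F j)) = l" using F[OF that] by (simp only: dim_pspan)
      show "vec.subspace (pspan (F j))" by (rule vec.subspace_span)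
    qed (rule ker)
    with f[OF that] show ?thesis by simp
  qed
  then have "v = 0\<^sub>v m" using v(1) by (intro eq_vecI) auto
  with v(2) show False by simp
qed

end
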